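(* Let $\gamma:I=[0,1]\to \mathrm{Sym}(2,\mathbb{R})$ be a smooth curve and let $E_0\in T_{\gamma(0)}\mathrm{Sym}(2,\mathbb{R})$ be an eigenvector of $\gamma(0)\in\mathrm{Sym}(2,\mathbb{R})$, in the sense that $E_0=E_0^1\,e_1(\gamma(0))+E_0^2\,e_2(\gamma(0))$ and $(E_0^1,E_0^2)^\top$ is an eigenvector of the matrix $\gamma(0)$. Furthermore, let $E$ be a vector field along $\gamma$, i.e. $E(t)\in T_{\gamma(t)}\mathrm{Sym}(2,\mathbb{R})$ for $t\in I$, which satisfies the initial value problem $$E(0)=E_0,\qquad \nabla_{\gamma'(t)}E(t)=0\ \text{ for all } t\in I.$$ Then $E(t)$ is an eigenvector of $\gamma(t)$ (in the same sense) for each $t\in I$.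
   Context: $\mathrm{Sym}(2,\mathbb{R})$ is the space of real symmetric $2\times2$ matrices, identified with $\mathbb{R}^3$ via global coordinates $(x,y,z)\leftrightarrow\begin{pmatrix} x+z & y \\ y & -x+z\end{pmatrix}$. Cylindrical coordinates $(r,\phi,z)$ are given by $(x,y)=(r\cos\phi,r\sin\phi)$, with $\partial_r=\cos\phi\,\partial_x+\sin\phi\,\partial_y$ and $\partial_\phi=-r\sin\phi\,\partial_x+r\cos\phi\,\partial_y$; they are well-defined everywhere apart from the singular line $L=\{(0,0,z):z\in\mathbb{R}\}$. $\mathrm{Sym}(2,\mathbb{R})$ carries the metric given in coordinates $(x,y,z)$ by $g=\begin{pmatrix}1+3x^2/r^2&3xy/r^2&0\\3xy/r^2&1+3y^2/r^2&0\\0&0&1\end{pmatrix}$, and $\nabla$ is its Levi-Civita connection; $\nabla_{\gamma'(t)}E(t)$ denotes the covariant derivative of $E$ along $\gamma$. The $g$-orthonormal reference frame is $e_1=\cos\phi\,\frac{\partial_r}{2}-\sin\phi\,\frac{\partial_\phi}{r}$, $e_2=\sin\phi\,\frac{\partial_r}{2}+\cos\phi\,\frac{\partial_\phi}{r}$, $e_3=\partial_z$. The formulas for $g$ and for the frame are singular along $L$.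
   Formalization: The curve γ is assumed to avoid the singular line L for all t in [0,1], since the metric g, its connection and the frame e_1, e_2 are undefined on L. *)

theory Defs
  imports "HOL-Analysis.Analysis"
begin

definition Sym2 :: "(real^2^2) set" where
  "Sym2 = {A. transpose A = A}"

definition coords_to_sym :: "real^3 \<Rightarrow> real^2^2" where
  "coords_to_sym p = vector [vector [p$1 + p$3, p$2], vector [p$2, - p$1 + p$3]]"

definition sym_coords :: "real^2^2 \<Rightarrow> real^3" where
  "sym_coords A = vector [(A$1$1 - A$2$2) / 2, A$1$2, (A$1$1 + A$2$2) / 2]"

lemma sym_coords_coords_to_sym: "sym_coords (coords_to_sym p) = p"
  by (simp add: sym_coords_def coords_to_sym_def vec_eq_iff forall_3)

lemma coords_to_sym_sym_coords:
  assumes "A \<in> Sym2"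
  shows "coords_to_sym (sym_coords A) = A"
proof -
  have "transpose A $ 2 $ 1 = A $ 2 $ 1"
    using assms by (simp only: Sym2_def mem_Collect_eq)
  then have "A $ 1 $ 2 = A $ 2 $ 1"
    by (simp add: transpose_def)
  then show ?thesis
    by (simp add: sym_coords_def coords_to_sym_def vec_eq_iff forall_2 field_simps)
qed

lemma coords_to_sym_in_Sym2: "coords_to_sym p \<in> Sym2"
  by (simp add: Sym2_def transpose_def coords_to_sym_def vec_eq_iff forall_2)

lemma bij_betw_coords_to_sym: "bij_betw coords_to_sym UNIV Sym2"
  by (rule bij_betw_byWitness[where f' = sym_coords])
     (auto simp: sym_coords_coords_to_sym coords_to_sym_sym_coords coords_to_sym_in_Sym2)

(* Points of Sym2 are matrices; all fields below are written in the coordinates (x, y, z) given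
   by sym_coords.  A tangent vector is the column of its components with respect to the
   coordinate frame d/dx, d/dy, d/dz. *)

definition cyl_r :: "real^3 \<Rightarrow> real" where
  "cyl_r p = sqrt ((p$1)\<^sup>2 + (p$2)\<^sup>2)"

(* The angle lies in (-pi, pi]; only its sine and cosine are used. *)
definition cyl_phi :: "real^3 \<Rightarrow> real" where
  "cyl_phi p = Arg (Complex (p$1) (p$2))"

lemma cyl_coords:
  "p$1 = cyl_r p * cos (cyl_phi p)" "p$2 = cyl_r p * sin (cyl_phi p)"
proof -
  have "rcis (cyl_r p) (cyl_phi p) = Complex (p$1) (p$2)"
    using rcis_cmod_Arg[of "Complex (p$1) (p$2)"] by (simp add: cyl_r_def cyl_phi_def complex_norm)
  then show "p$1 = cyl_r p * cos (cyl_phi p)" "p$2 = cyl_r p * sin (cyl_phi p)"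
    by (metis Re_rcis complex.sel(1), metis Im_rcis complex.sel(2))
qed

definition singular_line :: "(real^3) set" where
  "singular_line = {p. p$1 = 0 \<and> p$2 = 0}"

definition d_r :: "real^3 \<Rightarrow> real^3" where
  "d_r p = vector [cos (cyl_phi p), sin (cyl_phi p), 0]"

definition d_phi :: "real^3 \<Rightarrow> real^3" where
  "d_phi p = vector [- cyl_r p * sin (cyl_phi p), cyl_r p * cos (cyl_phi p), 0]"

definition frame1 :: "real^3 \<Rightarrow> real^3" where
  "frame1 p = (cos (cyl_phi p) / 2) *\<^sub>R d_r p - (sin (cyl_phi p) / cyl_r p) *\<^sub>R d_phi p"

definition frame2 :: "real^3 \<Rightarrow> real^3" where
  "frame2 p = (sin (cyl_phi p) / 2) *\<^sub>R d_r p + (cos (cyl_phi p) / cyl_r p) *\<^sub>R d_phi p"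

definition frame3 :: "real^3 \<Rightarrow> real^3" where
  "frame3 p = vector [0, 0, 1]"

definition sym_metric :: "real^3 \<Rightarrow> real^3^3" where
  "sym_metric p =
    vector [vector [1 + 3 * (p$1)\<^sup>2 / (cyl_r p)\<^sup>2, 3 * p$1 * p$2 / (cyl_r p)\<^sup>2, 0],
            vector [3 * p$1 * p$2 / (cyl_r p)\<^sup>2, 1 + 3 * (p$2)\<^sup>2 / (cyl_r p)\<^sup>2, 0],
            vector [0, 0, 1]]"

definition partial :: "3 \<Rightarrow> (real^3 \<Rightarrow> real) \<Rightarrow> real^3 \<Rightarrow> real" where
  "partial i f p = frechet_derivative f (at p) (axis i 1)"

(* christoffel p k i j is the coefficient of the k-th coordinate field in the covariant
   derivative of the j-th coordinate field along the i-th one, for the Levi-Civita connection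
   of sym_metric.  Meaningful only off singular_line, where sym_metric is smooth and positive definite;
   see christoffel_sym (torsion-freeness) and christoffel_metric (metric compatibility). *)
definition christoffel :: "real^3 \<Rightarrow> 3 \<Rightarrow> 3 \<Rightarrow> 3 \<Rightarrow> real" where
  "christoffel p k i j =
    (\<Sum>l\<in>UNIV. matrix_inv (sym_metric p) $ k $ l *
       (partial i (\<lambda>q. sym_metric q $ j $ l) p + partial j (\<lambda>q. sym_metric q $ i $ l) p
         - partial l (\<lambda>q. sym_metric q $ i $ j) p)) / 2"

lemma sym_metric_sym: "sym_metric p $ i $ j = sym_metric p $ j $ i"
proof -
  have "\<forall>i j. sym_metric p $ i $ j = sym_metric p $ j $ i"
    by (simp add: sym_metric_def forall_3)
  then show ?thesis by blast
qed

lemma det_sym_metric: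
  assumes "p \<notin> singular_line"
  shows "det (sym_metric p) = 4"
proof -
  have "(p$1)\<^sup>2 + (p$2)\<^sup>2 > 0"
    using assms by (auto simp: singular_line_def sum_power2_gt_zero_iff)
  then show ?thesis
    by (simp add: det_3 sym_metric_def cyl_r_def divide_simps) (auto simp: algebra_simps power2_eq_square)
qed

lemma frame_orthonormal:
  assumes "p \<notin> singular_line"
  defines "g \<equiv> \<lambda>u v. u \<bullet> (sym_metric p *v v)"
  shows "g (frame1 p) (frame1 p) = 1" "g (frame2 p) (frame2 p) = 1" "g (frame3 p) (frame3 p) = 1"
    "g (frame1 p) (frame2 p) = 0" "g (frame1 p) (frame3 p) = 0" "g (frame2 p) (frame3 p) = 0"
proof -
  define r c s where "r = cyl_r p" and "c = cos (cyl_phi p)" and "s = sin (cyl_phi p)"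
  define R T :: "real^3" where "R = vector [c, s, 0]" and "T = vector [- s, c, 0]"
  have "(p$1)\<^sup>2 + (p$2)\<^sup>2 \<noteq> 0"
    using assms by (simp add: singular_line_def sum_power2_eq_zero_iff)
  then have r: "r \<noteq> 0" by (simp add: r_def cyl_r_def)
  have cs: "s * s = 1 - c * c"
    using sin_squared_eq[of "cyl_phi p"] by (simp add: c_def s_def power2_eq_square)
  have cs': "s * (s * x) = x - c * (c * x)" for x
    unfolding mult.assoc[symmetric] cs by (simp add: algebra_simps)
  have m: "sym_metric p = vector [vector [1 + 3 * (c * c), 3 * (c * s), 0],
      vector [3 * (c * s), 1 + 3 * (s * s), 0], vector [0, 0, 1]]"
    using r by (simp add: sym_metric_def cyl_coords[of p] r_def[symmetric] c_def[symmetric]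
        s_def[symmetric] power2_eq_square)
  have mR: "sym_metric p *v R = 4 *\<^sub>R R" and mT: "sym_metric p *v T = T"
    and m3: "sym_metric p *v frame3 p = frame3 p"
    by (simp_all add: m R_def T_def frame3_def matrix_vector_mult_def sum_3 vec_eq_iff forall_3
        algebra_simps cs cs')
  have ip: "R \<bullet> R = 1" "T \<bullet> T = 1" "R \<bullet> T = 0" "T \<bullet> R = 0" "R \<bullet> frame3 p = 0" "T \<bullet> frame3 p = 0"
    "frame3 p \<bullet> frame3 p = 1"
    by (simp_all add: R_def T_def frame3_def inner_vec_def sum_3 cs)
  have f1: "frame1 p = (c / 2) *\<^sub>R R - s *\<^sub>R T" and f2: "frame2 p = (s / 2) *\<^sub>R R + c *\<^sub>R T"
    using r by (simp_all add: frame1_def frame2_def d_r_def d_phi_def R_def T_def r_def[symmetric]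
        c_def[symmetric] s_def[symmetric] vec_eq_iff forall_3)
  have m1: "sym_metric p *v frame1 p = (2 * c) *\<^sub>R R - s *\<^sub>R T"
    and m2: "sym_metric p *v frame2 p = (2 * s) *\<^sub>R R + c *\<^sub>R T"
    by (simp_all add: f1 f2 mR mT matrix_vector_mult_diff_distrib matrix_vector_right_distrib
        matrix_vector_mult_scaleR)
  show "g (frame1 p) (frame1 p) = 1" "g (frame2 p) (frame2 p) = 1" "g (frame3 p) (frame3 p) = 1"
    "g (frame1 p) (frame2 p) = 0" "g (frame1 p) (frame3 p) = 0" "g (frame2 p) (frame3 p) = 0"
    unfolding g_def m1 m2 m3
    by (simp_all add: f1 f2 inner_diff_left inner_diff_right inner_add_left inner_add_right ip cs)
qed

lemma christoffel_sym: "christoffel p k i j = christoffel p k j i"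
proof -
  have *: "(\<lambda>q. sym_metric q $ i $ j) = (\<lambda>q. sym_metric q $ j $ i)"
    by (simp add: sym_metric_sym)
  show ?thesis
    unfolding christoffel_def * by (simp add: add.commute)
qed

lemma christoffel_metric:
  assumes "p \<notin> singular_line"
  shows "partial k (\<lambda>q. sym_metric q $ i $ j) p =
    (\<Sum>l\<in>UNIV. christoffel p l k i * sym_metric p $ l $ j + christoffel p l k j * sym_metric p $ i $ l)"
proof -
  define F where "F i j m = partial i (\<lambda>q. sym_metric q $ j $ m) p + partial j (\<lambda>q. sym_metric q $ i $ m) p
    - partial m (\<lambda>q. sym_metric q $ i $ j) p" for i j m
  have swap: "partial a (\<lambda>q. sym_metric q $ b $ c) p = partial a (\<lambda>q. sym_metric q $ c $ b) p" for a b c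
    by (metis sym_metric_sym)
  have "invertible (sym_metric p)"
    using det_sym_metric[OF assms] by (simp add: invertible_det_nz)
  then have inv: "sym_metric p ** matrix_inv (sym_metric p) = mat 1"
    by (simp add: matrix_inv_def invertible_def) (metis (mono_tags, lifting) someI_ex)
  have lower: "(\<Sum>l\<in>UNIV. sym_metric p $ m $ l * christoffel p l a b) = F a b m / 2" for m a b
  proof -
    have "(\<Sum>l\<in>UNIV. sym_metric p $ m $ l * christoffel p l a b) =
        (\<Sum>n\<in>UNIV. (sym_metric p ** matrix_inv (sym_metric p)) $ m $ n * F a b n) / 2"
      unfolding christoffel_def F_def[symmetric] matrix_matrix_mult_def
      by (simp add: sum_3 algebra_simps add_divide_distrib)
    also have "\<dots> = F a b m / 2"
      by (simp add: inv mat_def if_distrib if_distribR cong: if_cong)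
    finally show ?thesis .
  qed
  have "(\<Sum>l\<in>UNIV. christoffel p l k i * sym_metric p $ l $ j + christoffel p l k j * sym_metric p $ i $ l)
      = F k i j / 2 + F k j i / 2"
    by (simp add: lower[symmetric] sum.distrib mult.commute sym_metric_sym[of p _ j])
  also have "\<dots> = partial k (\<lambda>q. sym_metric q $ i $ j) p"
    unfolding F_def using swap[of k i j] swap[of j k i] swap[of i k j] by (simp add: field_simps)
  finally show ?thesis by simp
qed

definition smooth_curve_on :: "real set \<Rightarrow> (real \<Rightarrow> 'a::real_normed_vector) \<Rightarrow> bool" where
  "smooth_curve_on I c \<longleftrightarrow>
    (\<exists>D. (\<forall>t\<in>I. D 0 t = c t) \<and>
         (\<forall>n. \<forall>t\<in>I. (D n has_vector_derivative D (Suc n) t) (at t within I)))"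

definition cov_deriv ::
    "real set \<Rightarrow> (real \<Rightarrow> real^2^2) \<Rightarrow> (real \<Rightarrow> real^3) \<Rightarrow> real \<Rightarrow> real^3" where
  "cov_deriv I \<gamma> E t =
    vector_derivative E (at t within I) +
    (\<chi> k. \<Sum>i\<in>UNIV. \<Sum>j\<in>UNIV. christoffel (sym_coords (\<gamma> t)) k i j *
       vector_derivative (\<lambda>s. sym_coords (\<gamma> s)) (at t within I) $ i * E t $ j)"

definition is_eigenvector :: "real^2^2 \<Rightarrow> real^2 \<Rightarrow> bool" where
  "is_eigenvector A v \<longleftrightarrow> v \<noteq> 0 \<and> (\<exists>\<mu>. A *v v = \<mu> *\<^sub>R v)"

definition tangent_eigenvector :: "real^2^2 \<Rightarrow> real^3 \<Rightarrow> bool" where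
  "tangent_eigenvector A v \<longleftrightarrow>
    (\<exists>a b. v = a *\<^sub>R frame1 (sym_coords A) + b *\<^sub>R frame2 (sym_coords A) \<and>
           is_eigenvector A (vector [a, b]))"

end

(* In cylindrical coordinates the metric is 4 dr^2 + r^2 dphi^2 + dz^2, a flat cone times a line.
   With zeta = x + i y, write a horizontal vector as a e_1 + b e_2 and put S = cnj zeta (a + i b).
   Parallel transport reads S' = S (zeta' / zeta + 3 cnj (zeta' / zeta)) / 4, so that
   S^4 / (zeta (cnj zeta)^3) is constant along the curve.  This quantity is a positive multiple of
   (cnj zeta (a + i b)^2)^2, and (a, b) is an eigenvector iff cnj zeta (a + i b)^2 is real and
   nonzero, i.e. iff its square is a positive real. *)
theory Submission
  imports Defs
begin

section \<open>Complex coordinates for horizontal vectors\<close>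

definition planar :: "real^3 \<Rightarrow> complex" where
  "planar p = Complex (p$1) (p$2)"

text \<open>This is r times the complex number formed by the horizontal components of v in the
  g-orthonormal pair \<open>d_r\<close> / 2, \<open>d_phi\<close> / r.\<close>

definition cone_coord :: "real^3 \<Rightarrow> real^3 \<Rightarrow> complex" where
  "cone_coord p v = Complex (2 * (p$1 * v$1 + p$2 * v$2)) (p$1 * v$2 - p$2 * v$1)"

text \<open>Transport makes S a constant multiple of zeta^(1/4) (cnj zeta)^(3/4); the fourth power
  avoids branches of these roots along the curve.\<close>

definition cone_invariant :: "real^3 \<Rightarrow> real^3 \<Rightarrow> complex" where
  "cone_invariant p v = cone_coord p v ^ 4 / (planar p * cnj (planar p) ^ 3)"

lemma cyl_r_sq: "(cyl_r p)\<^sup>2 = (p$1)\<^sup>2 + (p$2)\<^sup>2"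
  by (simp add: cyl_r_def)

lemma radius_sq_nonzero: "p \<notin> singular_line \<Longrightarrow> (p$1)\<^sup>2 + (p$2)\<^sup>2 \<noteq> 0"
  by (simp add: singular_line_def sum_power2_eq_zero_iff)

lemma planar_nonzero: "p \<notin> singular_line \<Longrightarrow> planar p \<noteq> 0"
  by (auto simp: singular_line_def planar_def complex_eq_iff)

section \<open>Metric and Christoffel symbols\<close>

text \<open>Used in two roles: at a point it is the radial field r d/dr; as a linear projection it
  is its own derivative, so \<open>horiz (axis m 1)\<close> is its m-th partial derivative.\<close>

definition horiz :: "real^3 \<Rightarrow> real^3" where
  "horiz p = vector [p$1, p$2, 0]"

lemma horiz_nth [simp]: "horiz p $ 1 = p$1" "horiz p $ 2 = p$2" "horiz p $ 3 = 0"
  by (simp_all add: horiz_def)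

lemma sym_metric_nth:
  assumes "p \<notin> singular_line"
  shows "sym_metric p $ i $ j = mat 1 $ i $ j + 3 * (horiz p $ i * horiz p $ j) / ((p$1)\<^sup>2 + (p$2)\<^sup>2)"
proof -
  have "\<forall>i j. sym_metric p $ i $ j = mat 1 $ i $ j + 3 * (horiz p $ i * horiz p $ j) / ((p$1)\<^sup>2 + (p$2)\<^sup>2)"
    by (simp add: forall_3 sym_metric_def cyl_r_sq mat_def) (simp add: power2_eq_square)
  then show ?thesis by blast
qed

text \<open>The metric scales the direction \<open>horiz p\<close> by 4 and fixes its Euclidean
  complement, so the inverse scales it by 1/4 = 1 - 3/4.\<close>

lemma matrix_inv_sym_metric:
  assumes "p \<notin> singular_line"
  shows "matrix_inv (sym_metric p) =
    (\<chi> i j. mat 1 $ i $ j - 3/4 * (horiz p $ i * horiz p $ j) / ((p$1)\<^sup>2 + (p$2)\<^sup>2))" (is "_ = ?B")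
proof -
  define q where "q = (p$1)\<^sup>2 + (p$2)\<^sup>2"
  have q: "q \<noteq> 0" using radius_sq_nonzero[OF assms] by (simp only: q_def real_sqrt_eq_0_iff not_False_eq_True)
  have right: "sym_metric p ** ?B = mat 1"
    using q
    by (simp add: vec_eq_iff forall_3 matrix_matrix_mult_def sum_3 sym_metric_nth[OF assms] mat_def
          q_def[symmetric] field_simps)
       (simp add: q_def power2_eq_square algebra_simps)
  then have "?B ** sym_metric p = mat 1"
    by (rule matrix_left_right_inverse[THEN iffD1])
  \<comment> \<open>\<open>matrix_inv\<close> is a Hilbert choice; the witness \<open>?B\<close>
    shows that a two-sided inverse exists, and uniqueness then identifies the chosen one.\<close>
  with right have "matrix_inv (sym_metric p) ** sym_metric p = mat 1"
    unfolding matrix_inv_def by - (rule someI2[of _ ?B], blast+)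
  then have "matrix_inv (sym_metric p) ** sym_metric p ** ?B = ?B"
    by (simp only: matrix_mul_lid)
  then show ?thesis
    by (simp only: matrix_mul_assoc[symmetric] right matrix_mul_rid)
qed

lemma partial_sym_metric:
  assumes "p \<notin> singular_line"
  shows "partial m (\<lambda>q. sym_metric q $ i $ j) p =
    3 * (horiz (axis m 1) $ i * horiz p $ j + horiz p $ i * horiz (axis m 1) $ j) / ((p$1)\<^sup>2 + (p$2)\<^sup>2)
    - 6 * (horiz p $ i * horiz p $ j * horiz p $ m) / ((p$1)\<^sup>2 + (p$2)\<^sup>2)\<^sup>2"
proof -
  define Q :: "real^3 \<Rightarrow> real" where "Q p = (p$1)\<^sup>2 + (p$2)\<^sup>2" for p
  have Q: "Q p \<noteq> 0" using radius_sq_nonzero[OF assms] by (simp only: Q_def real_sqrt_eq_0_iff not_False_eq_True)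
  have hor: "((\<lambda>q. horiz q $ i) has_derivative (\<lambda>h. horiz h $ i)) (at p)" for i
  proof -
    have "\<forall>i. bounded_linear (\<lambda>h. horiz h $ i)"
      by (simp add: forall_3 bounded_linear_vec_nth)
    then show ?thesis by (simp add: bounded_linear_imp_has_derivative)
  qed
  have Qd: "(Q has_derivative (\<lambda>h. 2 * (p$1 * h$1 + p$2 * h$2))) (at p)"
    unfolding Q_def
    by (auto intro!: derivative_eq_intros bounded_linear_imp_has_derivative
        bounded_linear_vec_nth simp: fun_eq_iff algebra_simps)
  have d: "((\<lambda>q. mat 1 $ i $ j + 3 * (horiz q $ i * horiz q $ j) / Q q) has_derivative
      (\<lambda>h. 3 * (horiz h $ i * horiz p $ j + horiz p $ i * horiz h $ j) / Q p
        - 6 * (horiz p $ i * horiz p $ j * (p$1 * h$1 + p$2 * h$2)) / (Q p)\<^sup>2)) (at p)"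
    using Q
    by (auto intro!: derivative_eq_intros hor Qd simp: fun_eq_iff field_simps power2_eq_square)
  \<comment> \<open>Openness makes the closed form of the metric valid near p, so its derivative
    carries over.\<close>
  have "open (- singular_line)"
  proof -
    have "closed singular_line"
      unfolding singular_line_def by (intro closed_Collect_conj closed_Collect_eq continuous_intros)
    then show ?thesis by (simp add: open_Compl)
  qed
  then have "((\<lambda>q. sym_metric q $ i $ j) has_derivative
      (\<lambda>h. 3 * (horiz h $ i * horiz p $ j + horiz p $ i * horiz h $ j) / Q p
        - 6 * (horiz p $ i * horiz p $ j * (p$1 * h$1 + p$2 * h$2)) / (Q p)\<^sup>2)) (at p)"
    by (rule has_derivative_transform_within_open[OF d])
      (use assms in \<open>auto simp: sym_metric_nth Q_def\<close>)
  then have "partial m (\<lambda>q. sym_metric q $ i $ j) p =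
      3 * (horiz (axis m 1) $ i * horiz p $ j + horiz p $ i * horiz (axis m 1) $ j) / Q p
        - 6 * (horiz p $ i * horiz p $ j * (p$1 * axis m 1 $ 1 + p$2 * axis m 1 $ 2)) / (Q p)\<^sup>2"
    unfolding partial_def by (simp flip: frechet_derivative_at)
  moreover have "\<forall>m. p$1 * axis m 1 $ 1 + p$2 * axis m 1 $ 2 = horiz p $ m"
    by (simp add: forall_3 axis_def)
  ultimately show ?thesis by (simp add: Q_def)
qed

(* In cylindrical coordinates only Gamma^r_{phi phi} differs from its Euclidean value,
   by 3 r / 4; the covector tau / r^2 below is dphi. *)
lemma christoffel_eq:
  fixes p :: "real^3"
  defines "\<tau> \<equiv> vector [- p$2, p$1, 0] :: real^3"
  assumes "p \<notin> singular_line"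
  shows "christoffel p k i j = 3/4 * (horiz p $ k * \<tau> $ i * \<tau> $ j) / ((p$1)\<^sup>2 + (p$2)\<^sup>2)\<^sup>2"
proof -
  define q where "q = (p$1)\<^sup>2 + (p$2)\<^sup>2"
  have q: "q \<noteq> 0" using radius_sq_nonzero[OF assms(2)] by (simp only: q_def real_sqrt_eq_0_iff not_False_eq_True)
  let ?P = "horiz p" and ?e = "\<lambda>i. horiz (axis i 1)"
  have e_sym: "?e i $ j = ?e j $ i" for i j
  proof -
    have "\<forall>i j. ?e i $ j = ?e j $ i" by (simp add: forall_3 axis_def)
    then show ?thesis by blast
  qed
  \<comment> \<open>\<open>?P\<close> and \<tau> are orthogonal with squared length q, so their
    rank-one matrices add up to q times the horizontal projection.\<close>
  have \<tau>: "\<tau> $ i * \<tau> $ j = q * ?e i $ j - ?P $ i * ?P $ j" for i j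
  proof -
    have "\<forall>i j. \<tau> $ i * \<tau> $ j = q * ?e i $ j - ?P $ i * ?P $ j"
      by (simp add: forall_3 axis_def \<tau>_def q_def power2_eq_square)
    then show ?thesis by blast
  qed
  \<comment> \<open>The terms with \<open>?e i $ l\<close> and \<open>?e j $ l\<close> cancel,
    leaving 6 \<open>?P $ l\<close> (q \<open>?e i $ j\<close> - \<open>?P $ i * ?P $ j\<close>) /
    q^2.\<close>
  have lower: "partial i (\<lambda>q. sym_metric q $ j $ l) p + partial j (\<lambda>q. sym_metric q $ i $ l) p
      - partial l (\<lambda>q. sym_metric q $ i $ j) p = 6 * ?P $ l * (\<tau> $ i * \<tau> $ j) / q\<^sup>2" for l
    unfolding partial_sym_metric[OF assms(2)] q_def[symmetric] \<tau> e_sym[of l] e_sym[of j i]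
    using q by (simp add: field_simps power2_eq_square)
  have P: "?P $ 1 * ?P $ 1 + ?P $ 2 * ?P $ 2 = q"
    by (simp add: q_def power2_eq_square)
  have "(\<Sum>l\<in>UNIV. (mat 1 $ k $ l - 3/4 * (?P $ k * ?P $ l) / q) * ?P $ l) =
      ?P $ k - 3/4 * ?P $ k * (?P $ 1 * ?P $ 1 + ?P $ 2 * ?P $ 2) / q" for k
  proof -
    have "(\<Sum>l\<in>UNIV. mat 1 $ k $ l * ?P $ l) = ?P $ k"
      using matrix_vector_mul_lid[of ?P] by (simp add: matrix_vector_mult_def vec_eq_iff)
    then show ?thesis
      by (simp add: sum_3 algebra_simps add_divide_distrib)
  qed
  then have raise: "(\<Sum>l\<in>UNIV. matrix_inv (sym_metric p) $ k $ l * ?P $ l) = ?P $ k / 4"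
    using q unfolding P matrix_inv_sym_metric[OF assms(2)] q_def[symmetric] by simp
  have "christoffel p k i j =
      (\<Sum>l\<in>UNIV. matrix_inv (sym_metric p) $ k $ l * ?P $ l) * (6 * (\<tau> $ i * \<tau> $ j) / q\<^sup>2) / 2"
    unfolding christoffel_def lower sum_distrib_right by (simp add: mult_ac)
  then show ?thesis by (simp add: raise q_def)
qed

section \<open>Eigenvector condition in complex form\<close>

text \<open>The frame e_1, e_2 is the orthonormal polar frame turned back by phi, so polar
  components arise from a + i b on multiplying by exp(-i phi); the factor r in
  \<open>cone_coord\<close> makes this cnj zeta.\<close>

lemma frame_combination_iff:
  assumes "p \<notin> singular_line"
  shows "v = a *\<^sub>R frame1 p + b *\<^sub>R frame2 p \<longleftrightarrow>
    v$3 = 0 \<and> cone_coord p v = cnj (planar p) * Complex a b"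
proof -
  define r c s where "r = cyl_r p" and "c = cos (cyl_phi p)" and "s = sin (cyl_phi p)"
  have r: "r \<noteq> 0" using radius_sq_nonzero[OF assms] by (simp only: r_def cyl_r_def real_sqrt_eq_0_iff not_False_eq_True)
  have p: "p$1 = r * c" "p$2 = r * s"
    by (simp_all add: r_def c_def s_def cyl_coords[of p, symmetric])
  have cs: "c * c + s * s = 1"
    by (simp add: c_def s_def flip: power2_eq_square)
  have f: "frame1 p = vector [c * c / 2 + s * s, - (c * s / 2), 0]"
    "frame2 p = vector [- (c * s / 2), s * s / 2 + c * c, 0]"
    using r by (simp_all add: frame1_def frame2_def d_r_def d_phi_def r_def[symmetric]
        c_def[symmetric] s_def[symmetric] vec_eq_iff forall_3)
  have "v = a *\<^sub>R frame1 p + b *\<^sub>R frame2 p \<longleftrightarrow> v$3 = 0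
      \<and> v$1 = a * (c * c / 2 + s * s) - b * (c * s / 2)
      \<and> v$2 = b * (s * s / 2 + c * c) - a * (c * s / 2)"
    by (auto simp: f vec_eq_iff forall_3 algebra_simps)
  also have "\<dots> \<longleftrightarrow> v$3 = 0 \<and> 2 * (c * v$1 + s * v$2) = c * a + s * b
      \<and> c * v$2 - s * v$1 = c * b - s * a" (is "?L \<longleftrightarrow> ?R")
  proof
    assume ?L
    then show ?R using cs by algebra
  next
    assume ?R
    then show ?L using cs by algebra
  qed
  also have "\<dots> \<longleftrightarrow> v$3 = 0 \<and> r * (2 * (c * v$1 + s * v$2)) = r * (c * a + s * b)
      \<and> r * (c * v$2 - s * v$1) = r * (c * b - s * a)"
    using r by simp
  also have "\<dots> \<longleftrightarrow> v$3 = 0 \<and> cone_coord p v = cnj (planar p) * Complex a b"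
    by (simp add: cone_coord_def planar_def p complex_eq_iff algebra_simps)
  finally show ?thesis .
qed

text \<open>The traceless part of A acts on w = a + i b as zeta cnj w. This is a real multiple of w
  exactly when zeta (cnj w)^2 is real.\<close>

lemma is_eigenvector_iff:
  assumes "A \<in> Sym2"
  shows "is_eigenvector A (vector [a, b]) \<longleftrightarrow>
    Complex a b \<noteq> 0 \<and> Im (cnj (planar (sym_coords A)) * (Complex a b)\<^sup>2) = 0"
proof -
  define x y z where "x = sym_coords A $ 1" and "y = sym_coords A $ 2" and "z = sym_coords A $ 3"
  have A: "A *v vector [a, b] = vector [(x + z) * a + y * b, y * a + (z - x) * b]"
    by (subst coords_to_sym_sym_coords[OF assms, symmetric])
      (simp add: coords_to_sym_def matrix_vector_mult_def vec_eq_iff forall_2 sum_2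
        x_def y_def z_def)
  have nz: "(vector [a, b] :: real^2) \<noteq> 0 \<longleftrightarrow> Complex a b \<noteq> 0"
    by (simp add: vec_eq_iff forall_2 complex_eq_iff)
  have im: "Im (cnj (planar (sym_coords A)) * (Complex a b)\<^sup>2) = 2 * x * a * b - y * (a * a - b * b)"
    by (simp add: planar_def x_def y_def power2_eq_square algebra_simps)
  have "(\<exists>\<mu>. A *v vector [a, b] = \<mu> *\<^sub>R vector [a, b]) \<longleftrightarrow>
      2 * x * a * b - y * (a * a - b * b) = 0" if "Complex a b \<noteq> 0"
  proof
    assume "\<exists>\<mu>. A *v vector [a, b] = \<mu> *\<^sub>R vector [a, b]"
    then obtain \<mu> where "(x + z) * a + y * b = \<mu> * a" "y * a + (z - x) * b = \<mu> * b"
      by (auto simp: A vec_eq_iff forall_2)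
    then show "2 * x * a * b - y * (a * a - b * b) = 0" by algebra
  next
    assume eq: "2 * x * a * b - y * (a * a - b * b) = 0"
    \<comment> \<open>With v = (a, b), n is |v|^2 and m is the inner product of A v and v; the
      eigenvalue is the Rayleigh quotient m / n.\<close>
    define n where "n = a * a + b * b"
    define m where "m = ((x + z) * a + y * b) * a + (y * a + (z - x) * b) * b"
    have n: "n \<noteq> 0" using that by (simp add: n_def complex_eq_iff sum_squares_eq_zero_iff)
    have "((x + z) * a + y * b) * n = m * a" "(y * a + (z - x) * b) * n = m * b"
      unfolding n_def m_def using eq by algebra+
    then have "A *v vector [a, b] = (m / n) *\<^sub>R vector [a, b]"
      using n by (simp add: A vec_eq_iff forall_2 field_simps)
    then show "\<exists>\<mu>. A *v vector [a, b] = \<mu> *\<^sub>R vector [a, b]" ..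
  qed
  then show ?thesis unfolding is_eigenvector_def nz im by blast
qed

lemma Im_zero_iff_square_pos:
  fixes w :: complex
  shows "w \<noteq> 0 \<and> Im w = 0 \<longleftrightarrow> Im (w\<^sup>2) = 0 \<and> Re (w\<^sup>2) > 0"
  by (cases w) (auto simp: power2_eq_square complex_eq_iff zero_less_mult_iff mult_less_0_iff
      not_sum_squares_lt_zero dest: mult_nonneg_nonneg)

text \<open>Expresses the property through two quantities that parallel transport preserves.\<close>

lemma tangent_eigenvector_iff:
  assumes "A \<in> Sym2" and "sym_coords A \<notin> singular_line"
  shows "tangent_eigenvector A v \<longleftrightarrow> v$3 = 0 \<and>
    Im (cone_invariant (sym_coords A) v) = 0 \<and> Re (cone_invariant (sym_coords A) v) > 0"
proof -
  let ?p = "sym_coords A"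
  let ?\<zeta> = "planar ?p"
  define w where "w = cone_coord ?p v / cnj ?\<zeta>"
  note \<zeta> = planar_nonzero[OF assms(2)]
  have w: "cone_coord ?p v = cnj ?\<zeta> * Complex a b \<longleftrightarrow> w = Complex a b" for a b
    using \<zeta> by (auto simp: w_def field_simps)
  \<comment> \<open>The existential over a, b collapses: \<open>w\<close> determines both as its
    real and imaginary parts.\<close>
  have "tangent_eigenvector A v \<longleftrightarrow> v$3 = 0 \<and> w \<noteq> 0 \<and> Im (cnj ?\<zeta> * w\<^sup>2) = 0"
    unfolding tangent_eigenvector_def frame_combination_iff[OF assms(2)]
      is_eigenvector_iff[OF assms(1)] w
    by (metis complex_surj)
  also have "\<dots> \<longleftrightarrow> v$3 = 0 \<and> Im ((cnj ?\<zeta> * w\<^sup>2)\<^sup>2) = 0 \<and> Re ((cnj ?\<zeta> * w\<^sup>2)\<^sup>2) > 0"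
    using \<zeta> Im_zero_iff_square_pos[of "cnj ?\<zeta> * w\<^sup>2"] by auto
  \<comment> \<open>Both sides equal S^4 / (cnj zeta)^2, and the factor |zeta|^2 is positive, so the
    sign conditions pass to the invariant.\<close>
  also have "(cnj ?\<zeta> * w\<^sup>2)\<^sup>2 = of_real ((cmod ?\<zeta>)\<^sup>2) * cone_invariant ?p v"
    unfolding complex_norm_square cone_invariant_def w_def using \<zeta>
    by (simp add: field_simps eval_nat_numeral)
  finally show ?thesis
    using \<zeta> by (simp add: zero_less_mult_iff)
qed

section \<open>The parallel transport equation\<close>

text \<open>4 S' = S (zeta' / zeta + 3 cnj (zeta' / zeta)), and the bracket is the logarithmic
  derivative of the denominator. Only \<zeta> is divided by, so S may vanish.\<close>

lemma cone_invariant_constant: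
  assumes S: "(S has_vector_derivative S t * (\<zeta>' / \<zeta> t + 3 * cnj (\<zeta>' / \<zeta> t)) / 4) (at t within I)"
    and \<zeta>: "(\<zeta> has_vector_derivative \<zeta>') (at t within I)" and nz: "\<zeta> t \<noteq> 0"
  shows "((\<lambda>t. S t ^ 4 / (\<zeta> t * cnj (\<zeta> t) ^ 3)) has_vector_derivative 0) (at t within I)"
proof -
  have c: "((\<lambda>t. cnj (\<zeta> t)) has_vector_derivative cnj \<zeta>') (at t within I)"
    by (rule bounded_linear.has_vector_derivative[OF bounded_linear_cnj \<zeta>])
  show ?thesis
    unfolding has_vector_derivative_def
    using nz
    by (auto intro!: derivative_eq_intros S[unfolded has_vector_derivative_def]
        \<zeta>[unfolded has_vector_derivative_def] c[unfolded has_vector_derivative_def]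
        simp: fun_eq_iff scaleR_conv_of_real field_simps eval_nat_numeral)
qed

text \<open>The Christoffel correction is radial: it changes only the real part of
  \<open>cone_coord\<close> and leaves the z-component alone.\<close>

lemma cone_coord_derivative:
  assumes p: "(p has_vector_derivative p') (at t within I)"
    and E: "(E has_vector_derivative E') (at t within I)"
    and nz: "p t \<notin> singular_line"
    and par: "E' + (\<chi> k. \<Sum>i\<in>UNIV. \<Sum>j\<in>UNIV. christoffel (p t) k i j * p' $ i * E t $ j) = 0"
  shows "((\<lambda>t. cone_coord (p t) (E t)) has_vector_derivative
      cone_coord (p t) (E t) * (planar p' / planar (p t) + 3 * cnj (planar p' / planar (p t))) / 4)
      (at t within I)" (is ?S)
    and "((\<lambda>t. E t $ 3) has_vector_derivative 0) (at t within I)" (is ?T)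
proof -
  define q where "q = (p t $ 1)\<^sup>2 + (p t $ 2)\<^sup>2"
  have q: "q \<noteq> 0" using radius_sq_nonzero[OF nz] by (simp only: q_def real_sqrt_eq_0_iff not_False_eq_True)
  define \<tau> :: "real^3" where "\<tau> = vector [- p t $ 2, p t $ 1, 0]"
  \<comment> \<open>Each Christoffel symbol is a product of factors in k, i and j separately, so the
    double sum splits into two inner products.\<close>
  have E'k: "E' $ k = - 3/4 * horiz (p t) $ k * (\<tau> \<bullet> p') * (\<tau> \<bullet> E t) / q\<^sup>2" for k
  proof -
    have "E' $ k = - (\<Sum>i\<in>UNIV. \<Sum>j\<in>UNIV. christoffel (p t) k i j * p' $ i * E t $ j)"
      using arg_cong[OF par, of "\<lambda>v. v $ k"] by (simp add: add_eq_0_iff2)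
    also have "\<dots> = - (\<Sum>i\<in>UNIV. \<Sum>j\<in>UNIV.
        (3/4 * horiz (p t) $ k / q\<^sup>2) * ((\<tau> $ i * p' $ i) * (\<tau> $ j * E t $ j)))"
      unfolding christoffel_eq[OF nz] \<tau>_def[symmetric] q_def[symmetric] by (simp add: mult_ac)
    also have "\<dots> = - 3/4 * horiz (p t) $ k * (\<tau> \<bullet> p') * (\<tau> \<bullet> E t) / q\<^sup>2"
      unfolding sum_distrib_left[symmetric] sum_distrib_right[symmetric] by (simp add: inner_vec_def)
    finally show ?thesis .
  qed
  have pk: "((\<lambda>t. p t $ k) has_real_derivative p' $ k) (at t within I)"
    and Ek: "((\<lambda>t. E t $ k) has_real_derivative E' $ k) (at t within I)" for k
    using bounded_linear.has_vector_derivative[OF bounded_linear_vec_nth p, of k]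
      bounded_linear.has_vector_derivative[OF bounded_linear_vec_nth E, of k]
    by (simp_all add: has_real_derivative_iff_has_vector_derivative)
  show ?T
    using Ek[of 3] by (simp add: E'k has_real_derivative_iff_has_vector_derivative)
  let ?p = "p t" and ?v = "E t"
  have \<tau>: "\<tau> \<bullet> u = ?p$1 * u$2 - ?p$2 * u$1" for u
    by (simp add: \<tau>_def inner_vec_def sum_3)
  define k where "k = 3/4 * (?p$1 * p'$2 - ?p$2 * p'$1) * (?p$1 * ?v$2 - ?p$2 * ?v$1) / q\<^sup>2"
  have E12: "E' $ 1 = - k * ?p$1" "E' $ 2 = - k * ?p$2"
    by (simp_all add: E'k k_def \<tau> mult_ac)
  have d: "((\<lambda>t. cone_coord (p t) (E t)) has_vector_derivative
      Complex (2 * (p'$1 * ?v$1 + p'$2 * ?v$2 - k * q)) (p'$1 * ?v$2 - p'$2 * ?v$1))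
      (at t within I)"
    unfolding cone_coord_def has_vector_derivative_complex_iff
      has_real_derivative_iff_has_vector_derivative[symmetric]
    by (auto intro!: derivative_eq_intros pk Ek simp: E12 q_def power2_eq_square algebra_simps)
  \<comment> \<open>\<alpha> / q is r' / r and \<beta> / q is phi'; u and w are the dot and cross
    products of the horizontal parts of \<open>?p\<close> and \<open>?v\<close>.\<close>
  define \<alpha> \<beta> where "\<alpha> = ?p$1 * p'$1 + ?p$2 * p'$2" and "\<beta> = ?p$1 * p'$2 - ?p$2 * p'$1"
  define u w where "u = ?p$1 * ?v$1 + ?p$2 * ?v$2" and "w = ?p$1 * ?v$2 - ?p$2 * ?v$1"
  note defs = \<alpha>_def \<beta>_def u_def w_def q_def
  have quot: "planar p' / planar ?p = Complex (\<alpha> / q) (\<beta> / q)"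
    by (simp add: complex_eq_iff planar_def Re_divide Im_divide defs algebra_simps)
  \<comment> \<open>Real and imaginary parts of (\<alpha> - i \<beta>) (u + i w) = q cnj(p') v, with
    horizontal parts read as complex numbers.\<close>
  have "(p'$1 * ?v$1 + p'$2 * ?v$2) * q = \<alpha> * u + \<beta> * w"
    "(p'$1 * ?v$2 - p'$2 * ?v$1) * q = \<alpha> * w - \<beta> * u"
    unfolding defs by algebra+
  then have pv: "p'$1 * ?v$1 + p'$2 * ?v$2 = (\<alpha> * u + \<beta> * w) / q"
    "p'$1 * ?v$2 - p'$2 * ?v$1 = (\<alpha> * w - \<beta> * u) / q"
    using q by (simp_all add: eq_divide_eq)
  have kq: "k * q = 3/4 * \<beta> * w / q"
    using q by (simp add: k_def \<beta>_def w_def power2_eq_square)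
  have cone: "cone_coord ?p ?v = Complex (2 * u) w"
    by (simp add: cone_coord_def u_def w_def)
  \<comment> \<open>The factor multiplying S is r' / r - i phi' / 2; the half angle reflects the
    total cone angle pi.\<close>
  have "Complex (2 * (p'$1 * ?v$1 + p'$2 * ?v$2 - k * q)) (p'$1 * ?v$2 - p'$2 * ?v$1) =
      cone_coord ?p ?v * (planar p' / planar ?p + 3 * cnj (planar p' / planar ?p)) / 4"
    unfolding quot cone pv kq using q by (simp add: complex_eq_iff field_simps)
  from d[unfolded this] show ?S .
qed

section \<open>Conservation along the curve\<close>

lemma bounded_linear_sym_coords: "bounded_linear sym_coords"
proof -
  have "linear sym_coords"
    by (rule linearI) (simp_all add: sym_coords_def vec_eq_iff forall_3 field_simps)
  then show ?thesis by (rule linear_conv_bounded_linear[THEN iffD1])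
qed

lemma bounded_linear_planar: "bounded_linear planar"
proof -
  have "linear planar"
    by (rule linearI) (simp_all add: planar_def complex_eq_iff)
  then show ?thesis by (rule linear_conv_bounded_linear[THEN iffD1])
qed

theorem proposition17:
  fixes \<gamma> :: "real \<Rightarrow> real^2^2" and E :: "real \<Rightarrow> real^3" and E0 :: "real^3"
  assumes "smooth_curve_on {0..1} \<gamma>"
    and "\<forall>t\<in>{0..1}. \<gamma> t \<in> Sym2"
    and "\<forall>t\<in>{0..1}. sym_coords (\<gamma> t) \<notin> singular_line"
    and "tangent_eigenvector (\<gamma> 0) E0"
    and "E differentiable_on {0..1}"
    and "E 0 = E0"
    and "\<forall>t\<in>{0..1}. cov_deriv {0..1} \<gamma> E t = 0"
  shows "\<forall>t\<in>{0..1}. tangent_eigenvector (\<gamma> t) (E t)"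
proof -
  define p where "p t = sym_coords (\<gamma> t)" for t
  define G where "G t = cone_invariant (p t) (E t)" for t
  have der: "(G has_vector_derivative 0) (at t within {0..1})"
    "((\<lambda>t. E t $ 3) has_vector_derivative 0) (at t within {0..1})" if t: "t \<in> {0..1}" for t
  proof -
    obtain D where D: "\<forall>t\<in>{0..1}. D 0 t = \<gamma> t"
      "\<forall>n. \<forall>t\<in>{0..1}. (D n has_vector_derivative D (Suc n) t) (at t within {0..1})"
      using assms(1) unfolding smooth_curve_on_def by blast
    \<comment> \<open>\<open>D 0\<close> is known to agree with \<gamma> only on the interval, so
      the derivative is transferred within it.\<close>
    have "(\<gamma> has_vector_derivative D 1 t) (at t within {0..1})"
      by (rule has_vector_derivative_transform[of _ _ _ "D 0"]) (use D t in auto)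
    then have "(p has_vector_derivative sym_coords (D 1 t)) (at t within {0..1})"
      unfolding p_def by (rule bounded_linear.has_vector_derivative[OF bounded_linear_sym_coords])
    then have p: "(p has_vector_derivative vector_derivative p (at t within {0..1})) (at t within {0..1})"
      using differentiableI_vector vector_derivative_works by blast
    have E: "(E has_vector_derivative vector_derivative E (at t within {0..1})) (at t within {0..1})"
      using assms(5) t vector_derivative_works unfolding differentiable_on_def by blast
    have nz: "p t \<notin> singular_line" using assms(3) t by (simp add: p_def)
    have par: "vector_derivative E (at t within {0..1}) + (\<chi> k. \<Sum>i\<in>UNIV. \<Sum>j\<in>UNIV.
        christoffel (p t) k i j * vector_derivative p (at t within {0..1}) $ i * E t $ j) = 0"
      using assms(7) t unfolding cov_deriv_def p_def by blast
    note S = cone_coord_derivative[OF p E nz par]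
    show "(G has_vector_derivative 0) (at t within {0..1})"
      unfolding G_def cone_invariant_def
      by (rule cone_invariant_constant[OF S(1) bounded_linear.has_vector_derivative[OF bounded_linear_planar p]
          planar_nonzero[OF nz]])
    show "((\<lambda>t. E t $ 3) has_vector_derivative 0) (at t within {0..1})"
      by (rule S(2))
  qed
  have const: "G t = G 0" "E t $ 3 = E 0 $ 3" if "t \<in> {0..1}" for t
  proof -
    obtain c where "\<And>s. s \<in> {0..1} \<Longrightarrow> G s = c"
      using has_vector_derivative_zero_constant[of "{0..1}" G] der(1) by auto
    then show "G t = G 0" using that by simp
    obtain c where "\<And>s. s \<in> {0..1} \<Longrightarrow> E s $ 3 = c"
      using has_vector_derivative_zero_constant[of "{0..1}" "\<lambda>t. E t $ 3"] der(2) by auto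
    then show "E t $ 3 = E 0 $ 3" using that by simp
  qed
  have iff: "tangent_eigenvector (\<gamma> t) (E t) \<longleftrightarrow> E t $ 3 = 0 \<and> Im (G t) = 0 \<and> Re (G t) > 0"
    if "t \<in> {0..1}" for t
    using tangent_eigenvector_iff assms(2,3) that by (simp add: G_def p_def)
  \<comment> \<open>The equivalence is read forwards at 0 and, after conservation, backwards at
    t.\<close>
  have init: "E 0 $ 3 = 0 \<and> Im (G 0) = 0 \<and> Re (G 0) > 0"
    using assms(4,6) iff[of 0] by simp
  show ?thesis
  proof
    fix t :: real assume "t \<in> {0..1}"
    from iff[OF this] const[OF this] init show "tangent_eigenvector (\<gamma> t) (E t)" by presburger
  qed
qed

end
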